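(* Let $F$ be a function from the nonnegative integers to the complex numbers. If $\{A_n\}_{n\ge0}$ is an even sequence, then $$\sum_{k=0}^n\binom nk(-1)^kA_k\Big(\sum_{s=0}^k\binom ks(-1)^s\big(F(s)-F(n-s)\big)\Big)=0\quad(n=0,1,2,\ldots).$$ If $\{A_n\}_{n\ge0}$ is an odd sequence, then $$\sum_{k=0}^n\binom nk(-1)^kA_k\Big(\sum_{s=0}^k\binom ks(-1)^s\big(F(s)+F(n-s)\big)\Big)=0\quad(n=0,1,2,\ldots).$$
   Context: A sequence $\{a_n\}_{n\ge0}$ of real (or complex) numbers is called an even sequence if $\sum_{k=0}^n\binom nk(-1)^ka_k=a_n$ for all $n=0,1,2,\ldots$, and an odd sequence if $\sum_{k=0}^n\binom nk(-1)^ka_k=-a_n$ for all $n=0,1,2,\ldots$. *)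

theory Defs
  imports Complex_Main
begin

text \<open>
  Sequences that are invariant, respectively inverted, under the binomial transform. The type is
  generic so that the definitions apply to real as well as complex sequences.
\<close>

definition even_sequence :: "(nat \<Rightarrow> 'a::comm_ring_1) \<Rightarrow> bool" where
  "even_sequence a \<longleftrightarrow> (\<forall>n. (\<Sum>k=0..n. of_nat (n choose k) * (-1) ^ k * a k) = a n)"

definition odd_sequence :: "(nat \<Rightarrow> 'a::comm_ring_1) \<Rightarrow> bool" where
  "odd_sequence a \<longleftrightarrow> (\<forall>n. (\<Sum>k=0..n. of_nat (n choose k) * (-1) ^ k * a k) = - a n)"

end

(*
  Let D m j = (\<Sum>i\<le>m. (m choose i) (-1)^i A (j + i)) be the iterated differences of A. Pascal's rule
  gives D (m + 1) j = D m j - D m (j + 1), so the hypothesis D m 0 = e * A m = e * D 0 m propagates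
  to the symmetry D m j = e * D j m, where e is 1 for even and -1 for odd sequences. The sum to be
  evaluated has coefficient (n choose s) (D (n - s) s - e * D s (n - s)) at F s.
*)
theory Submission
  imports Defs
begin

definition binomial_difference :: "(nat \<Rightarrow> 'a::comm_ring_1) \<Rightarrow> nat \<Rightarrow> nat \<Rightarrow> 'a" where
  "binomial_difference a m j = (\<Sum>i=0..m. of_nat (m choose i) * (-1) ^ i * a (j + i))"

lemma binomial_difference_0 [simp]: "binomial_difference a 0 j = a j"
  by (simp add: binomial_difference_def)

lemma binomial_difference_Suc:
  "binomial_difference a (Suc m) j = binomial_difference a m j - binomial_difference a m (Suc j)"
proof -
  let ?t = "\<lambda>i. of_nat (m choose i) * (-1) ^ i * a (j + i)"
  let ?u = "\<lambda>i. of_nat (m choose i) * (-1) ^ i * a (Suc j + i)"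
  have "binomial_difference a (Suc m) j
      = a j + (\<Sum>i=0..m. of_nat (Suc m choose Suc i) * (-1) ^ Suc i * a (j + Suc i))"
    unfolding binomial_difference_def by (subst sum.atLeast0_atMost_Suc_shift) simp
  \<comment> \<open>Pascal's rule splits \<open>Suc m choose Suc i\<close>; the part with
    \<open>m choose i\<close> gets the extra sign and becomes \<open>- ?u i\<close>.\<close>
  also have "\<dots> = a j + (\<Sum>i=0..m. ?t (Suc i) - ?u i)"
    by (intro arg_cong2[where f = "(+)"] sum.cong refl) (simp add: algebra_simps)
  also have "\<dots> = sum ?t {0..Suc m} - sum ?u {0..m}"
    by (simp only: sum.atLeast0_atMost_Suc_shift[of ?t] sum_subtractf) simp
  \<comment> \<open>The top term \<open>?t (Suc m)\<close> vanishes because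
    \<open>m choose Suc m\<close> is 0.\<close>
  also have "\<dots> = binomial_difference a m j - binomial_difference a m (Suc j)"
    by (simp add: binomial_difference_def binomial_eq_0)
  finally show ?thesis .
qed

text \<open>The recursion, solved for the entry at \<open>Suc j\<close>, trades a shift for one more
  difference. Both sides then obey the same rule in \<open>j\<close>, with \<open>Suc m\<close>
  appearing in it, so \<open>m\<close> must vary in the induction.\<close>

lemma binomial_difference_symmetric:
  assumes "\<And>m. binomial_difference a m 0 = e * a m"
  shows "binomial_difference a m j = e * binomial_difference a j m"
proof (induction j arbitrary: m)
  case 0
  then show ?case by (simp add: assms)
next
  case (Suc j)
  have "binomial_difference a m (Suc j)
      = binomial_difference a m j - binomial_difference a (Suc m) j"
    by (simp add: binomial_difference_Suc)
  also have "\<dots> = e * (binomial_difference a j m - binomial_difference a j (Suc m))"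
    by (simp only: Suc.IH right_diff_distrib)
  finally show ?case
    by (simp add: binomial_difference_Suc)
qed

text \<open>Exchanging the sums isolates the coefficient of each \<open>g s\<close>. With k = s + i,
  the identity (n choose k) (k choose s) = (n choose s) (n - s choose i) pulls out the factor free
  of i and leaves a difference of order n - s based at s.\<close>

lemma sum_binomial_transform_eq_binomial_difference:
  fixes a g :: "nat \<Rightarrow> 'a::comm_ring_1"
  shows "(\<Sum>k=0..n. of_nat (n choose k) * (-1) ^ k * a k *
      (\<Sum>s=0..k. of_nat (k choose s) * (-1) ^ s * g s))
    = (\<Sum>s=0..n. of_nat (n choose s) * binomial_difference a (n - s) s * g s)"
proof -
  let ?c = "\<lambda>k s. of_nat (n choose k) * (-1) ^ k * a k * (of_nat (k choose s) * (-1) ^ s * g s)"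
  have coeff: "(\<Sum>k=0..n. ?c k s) = of_nat (n choose s) * binomial_difference a (n - s) s * g s"
    if "s \<le> n" for s
  proof -
    have "(\<Sum>k=0..n. ?c k s) = (\<Sum>k=s..n. ?c k s)"
      by (rule sum.mono_neutral_right) (auto simp: not_le binomial_eq_0)
    also have "\<dots> = (\<Sum>i=0..n - s. ?c (s + i) s)"
      by (simp add: sum.atLeastAtMost_shift_0[OF that])
    also have "\<dots> = (\<Sum>i=0..n - s. of_nat (n choose s) *
        (of_nat ((n - s) choose i) * (-1) ^ i * a (s + i)) * g s)"
    proof (rule sum.cong[OF refl])
      fix i assume "i \<in> {0..n - s}"
      then have "(n choose (s + i)) * ((s + i) choose s) = (n choose s) * ((n - s) choose i)"
        using that choose_mult[of s "s + i" n] by simp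
      then have "(of_nat (n choose (s + i)) * of_nat ((s + i) choose s) :: 'a)
          = of_nat (n choose s) * of_nat ((n - s) choose i)"
        by (simp flip: of_nat_mult)
      \<comment> \<open>The exponents add up to 2 s + i, so only the sign of the difference
        survives.\<close>
      moreover have "(-1) ^ (s + i) * (-1) ^ s = ((-1) ^ i :: 'a)"
        by (simp add: uminus_power_if)
      moreover have "?c (s + i) s = (of_nat (n choose (s + i)) * of_nat ((s + i) choose s))
          * ((-1) ^ (s + i) * (-1) ^ s) * a (s + i) * g s"
        by (simp only: mult_ac)
      ultimately show "?c (s + i) s = of_nat (n choose s) *
          (of_nat ((n - s) choose i) * (-1) ^ i * a (s + i)) * g s"
        by (simp only: mult_ac)
    qed
    finally show ?thesis
      by (simp add: binomial_difference_def sum_distrib_left sum_distrib_right)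
  qed
  \<comment> \<open>Terms with s > k are zero, so the triangle of indices can be filled up to a
    square before swapping.\<close>
  have "(\<Sum>k=0..n. of_nat (n choose k) * (-1) ^ k * a k *
      (\<Sum>s=0..k. of_nat (k choose s) * (-1) ^ s * g s)) = (\<Sum>k=0..n. \<Sum>s=0..n. ?c k s)"
    unfolding sum_distrib_left
    by (intro sum.cong[OF refl] sum.mono_neutral_left) (auto simp: not_le binomial_eq_0)
  also have "\<dots> = (\<Sum>s=0..n. \<Sum>k=0..n. ?c k s)"
    by (rule sum.swap)
  finally show ?thesis
    by (simp add: coeff)
qed

text \<open>The parameter \<open>e\<close> treats both parities at once. Reflecting s to n - s turns
  the contribution of \<open>e * f (n - s)\<close> into that of \<open>f s\<close>, and the two
  cancel.\<close>

lemma sum_binomial_transform_antisymmetric_eq_0: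
  fixes a f :: "nat \<Rightarrow> 'a::comm_ring_1"
  assumes "\<And>m. binomial_difference a m 0 = e * a m"
  shows "(\<Sum>k=0..n. of_nat (n choose k) * (-1) ^ k * a k *
      (\<Sum>s=0..k. of_nat (k choose s) * (-1) ^ s * (f s - e * f (n - s)))) = 0"
proof -
  let ?D = "binomial_difference a"
  have "(\<Sum>s=0..n. of_nat (n choose s) * ?D (n - s) s * (e * f (n - s)))
      = (\<Sum>s=0..n. of_nat (n choose (n - s)) * ?D s (n - s) * (e * f s))"
    by (subst sum.atLeastAtMost_rev) (auto intro: sum.cong)
  also have "\<dots> = (\<Sum>s=0..n. of_nat (n choose s) * ?D (n - s) s * f s)"
  proof (rule sum.cong[OF refl])
    fix s assume "s \<in> {0..n}"
    then have "n choose (n - s) = n choose s"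
      by (simp flip: binomial_symmetric)
    \<comment> \<open>Used in this direction, the symmetry absorbs the factor \<open>e\<close>,
      which may thus be any ring element.\<close>
    moreover have "?D (n - s) s = e * ?D s (n - s)"
      by (rule binomial_difference_symmetric) (rule assms)
    ultimately show "of_nat (n choose (n - s)) * ?D s (n - s) * (e * f s)
        = of_nat (n choose s) * ?D (n - s) s * f s"
      by (simp only: mult_ac)
  qed
  finally show ?thesis
    by (simp add: sum_binomial_transform_eq_binomial_difference right_diff_distrib sum_subtractf)
qed

theorem theorem2p10:
  fixes F A :: "nat \<Rightarrow> complex"
  shows "(even_sequence A \<longrightarrow>
      (\<forall>n. (\<Sum>k=0..n. of_nat (n choose k) * (-1) ^ k * A k *
        (\<Sum>s=0..k. of_nat (k choose s) * (-1) ^ s * (F s - F (n - s)))) = 0))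
    \<and> (odd_sequence A \<longrightarrow>
      (\<forall>n. (\<Sum>k=0..n. of_nat (n choose k) * (-1) ^ k * A k *
        (\<Sum>s=0..k. of_nat (k choose s) * (-1) ^ s * (F s + F (n - s)))) = 0))"
proof (intro conjI impI allI)
  fix n assume "even_sequence A"
  then have "binomial_difference A m 0 = 1 * A m" for m
    by (simp add: even_sequence_def binomial_difference_def)
  from sum_binomial_transform_antisymmetric_eq_0[OF this]
  show "(\<Sum>k=0..n. of_nat (n choose k) * (-1) ^ k * A k *
      (\<Sum>s=0..k. of_nat (k choose s) * (-1) ^ s * (F s - F (n - s)))) = 0"
    by simp
next
  fix n assume "odd_sequence A"
  \<comment> \<open>Taking e = -1 turns \<open>f s - e * f (n - s)\<close> into the sum that the odd
    case asks for.\<close>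
  then have "binomial_difference A m 0 = - 1 * A m" for m
    by (simp add: odd_sequence_def binomial_difference_def)
  from sum_binomial_transform_antisymmetric_eq_0[OF this]
  show "(\<Sum>k=0..n. of_nat (n choose k) * (-1) ^ k * A k *
      (\<Sum>s=0..k. of_nat (k choose s) * (-1) ^ s * (F s + F (n - s)))) = 0"
    by simp
qed

end
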